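(* Let $A\in\mathbb{R}^{m\times n}$ have full row rank, let $B_k$ be the L-BFGS matrix described in the context, built from $S_k,Y_k\in\mathbb{R}^{n\times l}$ with $AS_k=0$, let $\sigma\ge 0$, and let $$V_k(\sigma)=(B_k+\sigma I)^{-1}-(B_k+\sigma I)^{-1}A^\top\bigl(A(B_k+\sigma I)^{-1}A^\top\bigr)^{-1}A(B_k+\sigma I)^{-1}.$$ Let $P=I_n-A^\top(AA^\top)^{-1}A$ and $Z_k=PY_k$, and put $\tau_k=\tau_k(\sigma)=1/\delta_k+\sigma$ and $\theta_k=\theta_k(\sigma)=\tau_k(\sigma)\bigl(1-\delta_k\tau_k(\sigma)\bigr)$. Then $$V_k(\sigma)=\frac1{\tau_k} I+\begin{bmatrix}A^\top & S_k & Z_k\end{bmatrix}\begin{bmatrix}-\frac1{\tau_k}(AA^\top)^{-1} & 0\\ 0 & N_k(\sigma)\end{bmatrix}\begin{bmatrix}A\\ S_k^\top\\ Z_k^\top\end{bmatrix},$$ where $$N_k(\sigma)=-\begin{bmatrix}\theta_k(\sigma)S_k^\top S_k & \theta_k(\sigma)L_k+\tau_k(\sigma)T_k\\ \theta_k(\sigma)L_k^\top+\tau_k(\sigma)T_k^\top & \tau_k(\sigma)\bigl(\tau_k(\sigma)D_k+Z_k^\top Z_k\bigr)\end{bmatrix}^{-1}.$$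
   Context: Setting: minimize $f(x)$ subject to $Ax=b$, with $f:\mathbb{R}^n\to\mathbb{R}$ and gradient $g$. Iterates $x_i$ are feasible ($Ax_i=b$). Put $s_i=x_{i+1}-x_i$ and $y_i=g(x_{i+1})-g(x_i)$, so $As_i=0$. For a memory parameter $l$ with $1\le l\le k$, let $S_k=[\,s_{k-l},\dots,s_{k-1}\,]\in\mathbb{R}^{n\times l}$ and $Y_k=[\,y_{k-l},\dots,y_{k-1}\,]\in\mathbb{R}^{n\times l}$. Write $S_k^\top Y_k=L_k+D_k+\bar T_k$ with $L_k$ strictly lower triangular, $D_k$ diagonal, $\bar T_k$ strictly upper triangular, and put $T_k=D_k+\bar T_k$. Let $\gamma_k>0$, $\delta_k=1/\gamma_k$, $J_k=[\,S_k\ \ Y_k\,]$. The L-BFGS matrix is $$B_k=\gamma_k I+J_kM_kJ_k^\top,\qquad M_k=-\begin{bmatrix}\delta_kS_k^\top S_k&\delta_kL_k\\ \delta_kL_k^\top&-D_k\end{bmatrix}^{-1}.$$ Standing assumptions: the inverse defining $M_k$ exists, $D_k$ (hence $T_k$) is nonsingular, and $B_k$ is positive definite. The matrix $V_k(\sigma)$ is the $(1,1)$ block of the inverse of the shifted KKT matrix $\begin{bmatrix}B_k+\sigma I&A^\top\\ A&0\end{bmatrix}$. *)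

theory Defs
  imports "HOL-Analysis.Analysis"
begin

text \<open>Block matrices are indexed by sum types; \<open>Inl\<close> addresses the left or upper part and
  \<open>Inr\<close> the right or lower part.\<close>

definition hcat :: "real^'a^'r \<Rightarrow> real^'b^'r \<Rightarrow> real^('a + 'b)^'r" where
  "hcat X Y = (\<chi> i j. case j of Inl p \<Rightarrow> X $ i $ p | Inr q \<Rightarrow> Y $ i $ q)"

definition vcat :: "real^'c^'a \<Rightarrow> real^'c^'b \<Rightarrow> real^'c^('a + 'b)" where
  "vcat X Y = (\<chi> i. case i of Inl p \<Rightarrow> X $ p | Inr q \<Rightarrow> Y $ q)"

definition block2x2 ::
  "real^'a^'r \<Rightarrow> real^'b^'r \<Rightarrow> real^'a^'q \<Rightarrow> real^'b^'q \<Rightarrow> real^('a + 'b)^('r + 'q)" where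
  "block2x2 X11 X12 X21 X22 = vcat (hcat X11 X12) (hcat X21 X22)"

definition posdef :: "real^'n^'n \<Rightarrow> bool" where
  "posdef B \<longleftrightarrow> transpose B = B \<and> (\<forall>x. x \<noteq> 0 \<longrightarrow> x \<bullet> (B *v x) > 0)"

definition strict_lower ::
  "real^('l::{finite,linorder})^('l::{finite,linorder}) \<Rightarrow>
   real^('l::{finite,linorder})^('l::{finite,linorder})" where
  "strict_lower G = (\<chi> i j. if j < i then G $ i $ j else 0)"

definition diagonal_part ::
  "real^('l::{finite,linorder})^('l::{finite,linorder}) \<Rightarrow>
   real^('l::{finite,linorder})^('l::{finite,linorder})" where
  "diagonal_part G = (\<chi> i j. if i = j then G $ i $ j else 0)"

definition strict_upper ::
  "real^('l::{finite,linorder})^('l::{finite,linorder}) \<Rightarrow>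
   real^('l::{finite,linorder})^('l::{finite,linorder})" where
  "strict_upper G = (\<chi> i j. if i < j then G $ i $ j else 0)"

definition lbfgs_L ::
  "real^('l::{finite,linorder})^'n \<Rightarrow>
   real^('l::{finite,linorder})^'n \<Rightarrow>
   real^('l::{finite,linorder})^('l::{finite,linorder})" where
  "lbfgs_L S Y = strict_lower (transpose S ** Y)"

definition lbfgs_D ::
  "real^('l::{finite,linorder})^'n \<Rightarrow>
   real^('l::{finite,linorder})^'n \<Rightarrow>
   real^('l::{finite,linorder})^('l::{finite,linorder})" where
  "lbfgs_D S Y = diagonal_part (transpose S ** Y)"

definition lbfgs_T ::
  "real^('l::{finite,linorder})^'n \<Rightarrow>
   real^('l::{finite,linorder})^'n \<Rightarrow>
   real^('l::{finite,linorder})^('l::{finite,linorder})" where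
  "lbfgs_T S Y = lbfgs_D S Y + strict_upper (transpose S ** Y)"

definition lbfgs_middle ::
  "real \<Rightarrow> real^('l::{finite,linorder})^'n \<Rightarrow> real^('l::{finite,linorder})^'n \<Rightarrow> real^('l + 'l)^('l + 'l)" where
  "lbfgs_middle \<delta> S Y =
     block2x2 (\<delta> *\<^sub>R (transpose S ** S)) (\<delta> *\<^sub>R lbfgs_L S Y)
              (\<delta> *\<^sub>R transpose (lbfgs_L S Y)) (- lbfgs_D S Y)"

text \<open>\<open>matrix_inv\<close> is unspecified on singular matrices, so \<open>lbfgs_B\<close> is
  meaningful only when \<open>lbfgs_middle (1 / \<gamma>) S Y\<close> is invertible.\<close>

definition lbfgs_B ::
  "real \<Rightarrow> real^('l::{finite,linorder})^'n \<Rightarrow> real^('l::{finite,linorder})^'n \<Rightarrow> real^'n^'n" where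
  "lbfgs_B \<gamma> S Y =
     (let J = hcat S Y; M = - matrix_inv (lbfgs_middle (1 / \<gamma>) S Y)
      in \<gamma> *\<^sub>R mat 1 + J ** M ** transpose J)"

text \<open>\<open>recent_columns v k\<close> is the matrix with columns \<open>v\<^sub>k\<^sub>-\<^sub>l, \<dots>, v\<^sub>k\<^sub>-\<^sub>1\<close>, where
  \<open>l = CARD('l) \<le> k\<close> and the columns are ordered by the linear order on \<open>'l\<close>.  Taking
  \<open>S = recent_columns (\<lambda>i. x (Suc i) - x i) k\<close> and
  \<open>Y = recent_columns (\<lambda>i. g (x (Suc i)) - g (x i)) k\<close> gives the L-BFGS matrix of an iterate
  sequence \<open>x\<close> and a gradient \<open>g\<close>; feasible iterates satisfy \<open>A ** S = 0\<close>.\<close>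

definition recent_columns :: "(nat \<Rightarrow> real^'n) \<Rightarrow> nat \<Rightarrow> real^('l::{finite,linorder})^'n" where
  "recent_columns v k = (\<chi> r j. v (k - CARD('l) + card {i. i < j}) $ r)"

lemma feasible_steps_in_kernel:
  fixes A :: "real^'n^'m" and x :: "nat \<Rightarrow> real^'n"
  assumes "\<And>i. A *v x i = b"
  shows "A ** (recent_columns (\<lambda>i. x (Suc i) - x i) k :: real^('l::{finite,linorder})^'n) = 0"
proof -
  have *: "A *v (x (Suc i) - x i) = 0" for i
    using assms by (simp add: matrix_vector_mult_diff_distrib)
  have "(\<Sum>r\<in>UNIV. A $ p $ r * (x (Suc i) - x i) $ r) = 0" for p i
    using *[of i] by (simp add: vec_eq_iff matrix_vector_mult_def)
  then show ?thesis
    by (simp add: vec_eq_iff matrix_matrix_mult_def recent_columns_def)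
qed

end

theory Submission
  imports Defs
begin

text \<open>
  Write \<open>H = B + \<sigma> I\<close> and let \<open>P\<close> be the orthogonal projector onto the kernel of \<open>A\<close>.  The matrix
  \<open>V\<close> is the inverse of the compression of \<open>H\<close> to that kernel: \<open>V A\<^sup>T = 0\<close>, while \<open>V H\<close> differs from
  the identity by a matrix ending in the factor \<open>A\<close>.  Hence every \<open>F\<close> with \<open>P F = F\<close> and
  \<open>P H F = P\<close> must be \<open>V\<close>
  (lemma \<open>nullspace_inverse_unique\<close>), and it is enough to find one.

  Since \<open>A S = 0\<close>, projecting fixes \<open>S\<close> and turns \<open>Y\<close> into \<open>Z\<close>, so with \<open>J = [S Z]\<close> and \<open>C\<close> the middle
  matrix of the L-BFGS formula, \<open>P H P = \<tau> P - J C\<^sup>-\<^sup>1 J\<^sup>T\<close>.  This is a scaled projector plus a low-rank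
  term, so the Sherman-Morrison-Woodbury identity, carried out inside the range of \<open>P\<close>, inverts it
  there: the inverse is \<open>P/\<tau> - J (\<tau> J\<^sup>T J - \<tau>\<^sup>2 C)\<^sup>-\<^sup>1 J\<^sup>T\<close> (lemma \<open>woodbury_on_range\<close>).  The capacitance
  matrix \<open>\<tau> J\<^sup>T J - \<tau>\<^sup>2 C\<close> is the block matrix \<open>K\<close> of the theorem: the off-diagonal block
  \<open>S\<^sup>T Z = S\<^sup>T Y = L + T\<close> is where the triangular splitting enters.

  The same compression shows that \<open>K\<close> is invertible.  A kernel vector \<open>u\<close> of \<open>K\<close> gives \<open>w = J u\<close> in the range of
  \<open>P\<close> with \<open>P H w = 0\<close>; positive definiteness of \<open>H\<close> forces \<open>w = 0\<close>, then \<open>C u = 0\<close>, and \<open>u = 0\<close>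
  because \<open>C\<close> is invertible (lemma \<open>capacitance_invertible\<close>).
\<close>

section \<open>Matrix arithmetic and inverses\<close>

lemma matrix_mul_scaleR_left: "(c *\<^sub>R X) ** Y = c *\<^sub>R (X ** Y)"
  for X :: "real^'b^'a" and Y :: "real^'c^'b"
  by (simp add: vec_eq_iff matrix_matrix_mult_def sum_distrib_left algebra_simps)

lemma matrix_mul_scaleR_right: "X ** (c *\<^sub>R Y) = c *\<^sub>R (X ** Y)"
  for X :: "real^'b^'a" and Y :: "real^'c^'b"
  by (simp add: vec_eq_iff matrix_matrix_mult_def sum_distrib_left algebra_simps)

lemma matrix_mul_add_left: "(X + X') ** Y = X ** Y + X' ** Y"
  for X :: "real^'b^'a" and Y :: "real^'c^'b"
  by (simp add: vec_eq_iff matrix_matrix_mult_def sum.distrib algebra_simps)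

lemma matrix_mul_diff_left: "(X - X') ** Y = X ** Y - X' ** Y"
  for X :: "real^'b^'a" and Y :: "real^'c^'b"
  by (simp add: vec_eq_iff matrix_matrix_mult_def sum_subtractf algebra_simps)

lemma matrix_mul_diff_right: "X ** (Y - Y') = X ** Y - X ** Y'"
  for X :: "real^'b^'a" and Y :: "real^'c^'b"
  by (simp add: vec_eq_iff matrix_matrix_mult_def sum_subtractf algebra_simps)

lemma matrix_mul_minus_left: "(- X) ** Y = - (X ** Y)"
  for X :: "real^'b^'a" and Y :: "real^'c^'b"
  by (simp add: vec_eq_iff matrix_matrix_mult_def sum_negf)

lemma matrix_mul_minus_right: "X ** (- Y) = - (X ** Y)"
  for X :: "real^'b^'a" and Y :: "real^'c^'b"
  by (simp add: vec_eq_iff matrix_matrix_mult_def sum_negf)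

lemma matrix_mul_zero_left: "0 ** Y = 0" for Y :: "real^'c^'b"
  by (simp add: vec_eq_iff matrix_matrix_mult_def)

lemma matrix_mul_zero_right: "X ** 0 = 0" for X :: "real^'b^'a"
  by (simp add: vec_eq_iff matrix_matrix_mult_def)

lemmas matrix_arith =
  matrix_mul_scaleR_left matrix_mul_scaleR_right matrix_mul_add_left matrix_add_ldistrib
  matrix_mul_diff_left matrix_mul_diff_right matrix_mul_minus_left matrix_mul_minus_right
  matrix_mul_zero_left matrix_mul_zero_right

lemma transpose_add: "transpose (X + Y) = transpose X + transpose Y" for X Y :: "real^'b^'a"
  by (simp add: vec_eq_iff transpose_def)

lemma transpose_diff: "transpose (X - Y) = transpose X - transpose Y" for X Y :: "real^'b^'a"
  by (simp add: vec_eq_iff transpose_def)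

lemma
  fixes X :: "real^'n^'n"
  assumes "invertible X"
  shows matrix_inv_mul_right: "X ** matrix_inv X = mat 1"
    and matrix_inv_mul_left: "matrix_inv X ** X = mat 1"
  using someI_ex[of "\<lambda>X'. X ** X' = mat 1 \<and> X' ** X = mat 1"] assms
  unfolding invertible_def matrix_inv_def by blast+

lemma invertible_if_trivial_kernel:
  fixes X :: "real^'n^'n"
  assumes "\<And>x. X *v x = 0 \<Longrightarrow> x = 0"
  shows "invertible X"
  using assms matrix_left_invertible_ker[of X] invertible_left_inverse by blast

lemma transpose_matrix_inv_symmetric:
  fixes X :: "real^'n^'n"
  assumes "transpose X = X" and "invertible X"
  shows "transpose (matrix_inv X) = matrix_inv X"
proof -
  have "transpose (matrix_inv X) ** X = mat 1"
    using matrix_inv_mul_right[OF assms(2)] assms(1)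
    by (metis matrix_transpose_mul transpose_mat)
  then show ?thesis
    using matrix_inv_mul_right[OF assms(2)] by (metis matrix_mul_assoc matrix_mul_lid matrix_mul_rid)
qed

section \<open>Positive definite matrices\<close>

lemma posdef_trivial_kernel: "posdef X \<Longrightarrow> X *v x = 0 \<Longrightarrow> x = 0"
  unfolding posdef_def by (metis inner_zero_right less_irrefl)

lemma posdef_invertible: "posdef X \<Longrightarrow> invertible X"
  by (blast intro: invertible_if_trivial_kernel posdef_trivial_kernel)

lemma posdef_mat_1: "posdef (mat 1 :: real^'n^'n)"
  by (simp add: posdef_def)

lemma posdef_shift:
  assumes "posdef X" and "\<sigma> \<ge> 0"
  shows "posdef (X + \<sigma> *\<^sub>R mat 1)"
  using assms
  by (auto simp: posdef_def transpose_add transpose_scalar matrix_vector_mult_add_rdistrib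
      inner_add_right scaleR_matrix_vector_assoc[symmetric] intro!: add_pos_nonneg)

text \<open>Substituting \<open>x = X y\<close> turns the quadratic form of \<open>X\<^sup>-\<^sup>1\<close> at \<open>x\<close> into that of \<open>X\<close> at \<open>y\<close>.\<close>

lemma posdef_matrix_inv:
  fixes X :: "real^'n^'n"
  assumes "posdef X"
  shows "posdef (matrix_inv X)"
proof -
  have inv: "invertible X" and sym: "transpose X = X"
    using assms posdef_invertible by (auto simp: posdef_def)
  have "x \<bullet> (matrix_inv X *v x) > 0" if "x \<noteq> 0" for x
  proof -
    define y where "y = matrix_inv X *v x"
    have x: "x = X *v y"
      by (simp add: y_def matrix_vector_mul_assoc matrix_inv_mul_right[OF inv])
    then have "y \<noteq> 0" using that by auto
    then have "y \<bullet> x > 0" using assms x by (simp add: posdef_def)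
    then show ?thesis by (simp add: y_def inner_commute)
  qed
  then show ?thesis
    using transpose_matrix_inv_symmetric[OF sym inv] by (simp add: posdef_def)
qed

text \<open>Full row rank of \<open>A\<close> makes \<open>A\<^sup>T\<close> injective, so no nonzero vector is lost in \<open>x \<mapsto> A\<^sup>T x\<close>.\<close>

lemma posdef_congruence:
  fixes A :: "real^'n^'m" and X :: "real^'n^'n"
  assumes "posdef X" and "rank A = CARD('m)"
  shows "posdef (A ** X ** transpose A)"
proof -
  have inj: "inj ((*v) (transpose A))"
    using assms(2) full_rank_injective[of "transpose A"] by (simp add: rank_transpose)
  have "x \<bullet> ((A ** X ** transpose A) *v x) > 0" if "x \<noteq> 0" for x
  proof -
    have "transpose A *v x \<noteq> 0"
      using that inj by (metis injD matrix_vector_mult_0_right)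
    then have "(transpose A *v x) \<bullet> (X *v (transpose A *v x)) > 0"
      using assms(1) by (simp add: posdef_def)
    then show ?thesis
      by (simp add: matrix_vector_mul_assoc[symmetric] dot_lmul_matrix)
  qed
  moreover have "transpose (A ** X ** transpose A) = A ** X ** transpose A"
    using assms(1) by (simp add: posdef_def matrix_transpose_mul matrix_mul_assoc)
  ultimately show ?thesis by (simp add: posdef_def)
qed

section \<open>Block matrices\<close>

lemma transpose_hcat: "transpose (hcat X Y) = vcat (transpose X) (transpose Y)"
  by (simp add: vec_eq_iff transpose_def hcat_def vcat_def split: sum.splits)

lemma sum_UNIV_Plus:
  fixes f :: "'a::finite + 'b::finite \<Rightarrow> real"
  shows "sum f UNIV = (\<Sum>p\<in>UNIV. f (Inl p)) + (\<Sum>q\<in>UNIV. f (Inr q))"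
  using sum.Plus[of UNIV UNIV f] by (simp add: UNIV_Plus_UNIV o_def)

lemma hcat_mul_vcat: "hcat X Y ** vcat U V = X ** U + Y ** V"
  by (simp add: vec_eq_iff matrix_matrix_mult_def sum_UNIV_Plus hcat_def vcat_def)

lemma mul_hcat: "M ** hcat X Y = hcat (M ** X) (M ** Y)"
  by (simp add: vec_eq_iff matrix_matrix_mult_def hcat_def split: sum.splits)

lemma vcat_mul: "vcat X Y ** M = vcat (X ** M) (Y ** M)"
  by (simp add: vec_eq_iff matrix_matrix_mult_def vcat_def split: sum.splits)

lemma scaleR_block2x2:
  "c *\<^sub>R block2x2 X11 X12 X21 X22 = block2x2 (c *\<^sub>R X11) (c *\<^sub>R X12) (c *\<^sub>R X21) (c *\<^sub>R X22)"
  by (simp add: vec_eq_iff block2x2_def hcat_def vcat_def split: sum.splits)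

lemma diff_block2x2:
  "block2x2 X11 X12 X21 X22 - block2x2 Y11 Y12 Y21 Y22
     = block2x2 (X11 - Y11) (X12 - Y12) (X21 - Y21) (X22 - Y22)"
  by (simp add: vec_eq_iff block2x2_def hcat_def vcat_def split: sum.splits)

lemma gram_hcat:
  "transpose (hcat S Z) ** hcat S Z
     = block2x2 (transpose S ** S) (transpose S ** Z) (transpose Z ** S) (transpose Z ** Z)"
  unfolding transpose_hcat vcat_mul block2x2_def by (simp only: mul_hcat)

lemma block_diagonal_sandwich:
  "hcat X Y ** block2x2 M 0 0 N ** vcat U V = X ** M ** U + Y ** N ** V"
proof -
  have "hcat X Y ** block2x2 M 0 0 N = hcat (X ** M) (Y ** N)"
    unfolding block2x2_def by (simp add: hcat_mul_vcat mul_hcat matrix_arith)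
      (simp add: vec_eq_iff hcat_def split: sum.splits)
  then show ?thesis by (simp add: hcat_mul_vcat)
qed

section \<open>Inverses compressed to a subspace\<close>

text \<open>
  Multiplying out gives \<open>V A\<^sup>T = 0\<close> and \<open>V H = I - R A\<close> for some \<open>R\<close>.  The first yields \<open>V P = V\<close>, because
  \<open>I - P\<close> begins with the factor \<open>A\<^sup>T\<close>; the second yields \<open>V H P = P\<close>, because \<open>A P = 0\<close>.  Therefore
  \<open>V = V P = V (P H F) = V H F = (V H P) F = P F = F\<close>.
\<close>

lemma nullspace_inverse_unique:
  fixes A :: "real^'n^'m" and H W P F V :: "real^'n^'n" and X :: "real^'n^'m"
  assumes WH: "W ** H = mat 1"
    and G: "invertible (A ** W ** transpose A)"
    and V: "V = W - W ** transpose A ** matrix_inv (A ** W ** transpose A) ** A ** W"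
    and P: "P = mat 1 - transpose A ** X" and AP: "A ** P = 0"
    and PF: "P ** F = F" and PHF: "P ** H ** F = P"
  shows "V = F"
proof -
  define R where "R = W ** transpose A ** matrix_inv (A ** W ** transpose A)"
  have V': "V = W - R ** (A ** W)" by (simp add: V R_def matrix_mul_assoc)
  have "R ** (A ** W ** transpose A) = W ** transpose A"
    unfolding R_def using matrix_inv_mul_left[OF G] by (simp flip: matrix_mul_assoc)
  then have "V ** transpose A = 0"
    by (simp add: V' matrix_arith matrix_mul_assoc)
  then have VP: "V ** P = V"
    by (simp add: P matrix_arith matrix_mul_assoc)
  have "V ** H = mat 1 - R ** A"
    by (simp add: V' matrix_arith WH flip: matrix_mul_assoc)
  then have VHP: "V ** H ** P = P"
    by (simp add: matrix_arith AP flip: matrix_mul_assoc)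
  have "V = V ** (P ** H ** F)" using VP PHF by simp
  also have "\<dots> = V ** H ** F" by (simp add: matrix_mul_assoc VP)
  also have "\<dots> = V ** H ** P ** F" using PF by (simp flip: matrix_mul_assoc)
  also have "\<dots> = F" using VHP PF by simp
  finally show ?thesis .
qed

text \<open>
  After expansion, everything but \<open>P\<close> is sandwiched between \<open>J\<close> and \<open>J\<^sup>T\<close>.  Substituting
  \<open>J\<^sup>T J = (K + \<tau>\<^sup>2 C) / \<tau>\<close> into the quadratic term makes it cancel the two linear ones.
\<close>

lemma woodbury_on_range:
  fixes P :: "real^'n^'n" and J :: "real^'p^'n" and C K :: "real^'p^'p"
  assumes PP: "P ** P = P" and sym: "transpose P = P" and PJ: "P ** J = J"
    and C: "invertible C" and K: "K = \<tau> *\<^sub>R (transpose J ** J) - \<tau>\<^sup>2 *\<^sub>R C"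
    and Kinv: "invertible K" and \<tau>: "\<tau> \<noteq> 0"
  shows "(\<tau> *\<^sub>R P - J ** matrix_inv C ** transpose J)
           ** ((1 / \<tau>) *\<^sub>R P - J ** matrix_inv K ** transpose J) = P"
proof -
  let ?C = "matrix_inv C" and ?K = "matrix_inv K" and ?J = "transpose J"
  have JP: "?J ** P = ?J"
    using arg_cong[OF PJ, of transpose] by (simp add: matrix_transpose_mul sym)
  have gram: "?J ** J = (1 / \<tau>) *\<^sub>R K + \<tau> *\<^sub>R C"
    using \<tau> by (simp add: K algebra_simps power2_eq_square)
  have "?C ** (?J ** J) ** ?K = (1 / \<tau>) *\<^sub>R (?C ** (K ** ?K)) + \<tau> *\<^sub>R (?C ** C ** ?K)"
    by (simp add: gram matrix_arith matrix_mul_assoc)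
  then have mid: "?C ** (?J ** J) ** ?K = (1 / \<tau>) *\<^sub>R ?C + \<tau> *\<^sub>R ?K"
    by (simp add: matrix_inv_mul_right[OF Kinv] matrix_inv_mul_left[OF C])
  have PJ': "P ** (J ** M) = J ** M" for M :: "real^'n^'p"
    by (simp add: matrix_mul_assoc PJ)
  have quad: "J ** (?C ** (?J ** (J ** (?K ** ?J))))
      = (1 / \<tau>) *\<^sub>R (J ** (?C ** ?J)) + \<tau> *\<^sub>R (J ** (?K ** ?J))"
  proof -
    have "J ** (?C ** (?J ** (J ** (?K ** ?J)))) = J ** (?C ** (?J ** J) ** ?K) ** ?J"
      by (simp add: matrix_mul_assoc)
    also have "\<dots> = (1 / \<tau>) *\<^sub>R (J ** (?C ** ?J)) + \<tau> *\<^sub>R (J ** (?K ** ?J))"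
      unfolding mid by (simp add: matrix_arith flip: matrix_mul_assoc)
    finally show ?thesis .
  qed
  show ?thesis
    using \<tau> by (simp add: matrix_arith PP JP PJ' quad algebra_simps flip: matrix_mul_assoc)
qed

text \<open>
  A kernel vector \<open>u\<close> of the capacitance matrix produces \<open>J u\<close>, a kernel vector of the compressed
  matrix that lies in the range of \<open>P\<close>; this is one half of the usual equivalence between
  singularity of a low-rank update and of its capacitance matrix.
\<close>

lemma capacitance_invertible:
  fixes P :: "real^'n^'n" and J :: "real^'p^'n" and C :: "real^'p^'p"
  assumes PJ: "P ** J = J" and C: "invertible C" and \<tau>: "\<tau> \<noteq> 0"
    and ker: "\<And>w. P *v w = w \<Longrightarrow> (\<tau> *\<^sub>R P - J ** matrix_inv C ** transpose J) *v w = 0 \<Longrightarrow> w = 0"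
  shows "invertible (\<tau> *\<^sub>R (transpose J ** J) - \<tau>\<^sup>2 *\<^sub>R C)"
proof (rule invertible_if_trivial_kernel)
  fix u assume u: "(\<tau> *\<^sub>R (transpose J ** J) - \<tau>\<^sup>2 *\<^sub>R C) *v u = 0"
  define w where "w = J *v u"
  have Pw: "P *v w = w" by (simp add: w_def matrix_vector_mul_assoc PJ)
  have "\<tau> *\<^sub>R ((transpose J ** J) *v u) = \<tau> *\<^sub>R (\<tau> *\<^sub>R (C *v u))"
    using u by (simp add: matrix_vector_mult_diff_rdistrib scaleR_matrix_vector_assoc[symmetric]
        power2_eq_square)
  then have gram: "(transpose J ** J) *v u = \<tau> *\<^sub>R (C *v u)"
    using \<tau> by (metis scaleR_cancel_left)
  have "(J ** matrix_inv C ** transpose J) *v w = (J ** matrix_inv C) *v ((transpose J ** J) *v u)"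
    by (simp only: w_def matrix_vector_mul_assoc matrix_mul_assoc)
  also have "\<dots> = \<tau> *\<^sub>R (J *v ((matrix_inv C ** C) *v u))"
    by (simp only: gram matrix_vector_mult_scaleR matrix_vector_mul_assoc matrix_mul_assoc)
  also have "\<dots> = \<tau> *\<^sub>R w"
    by (simp add: matrix_inv_mul_left[OF C] w_def)
  finally have "(\<tau> *\<^sub>R P - J ** matrix_inv C ** transpose J) *v w = 0"
    by (simp add: matrix_vector_mult_diff_rdistrib scaleR_matrix_vector_assoc[symmetric] Pw)
  then have "w = 0" using ker Pw by blast
  then have "\<tau> *\<^sub>R (C *v u) = 0"
    using gram by (simp add: w_def flip: matrix_vector_mul_assoc)
  then have "C *v u = 0" using \<tau> by simp
  then have "(matrix_inv C ** C) *v u = 0"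
    by (simp flip: matrix_vector_mul_assoc)
  then show "u = 0" by (simp add: matrix_inv_mul_left[OF C])
qed

section \<open>The projected L-BFGS matrix\<close>

lemma lbfgs_triangular_splitting: "lbfgs_L S Y + lbfgs_T S Y = transpose S ** Y"
  by (auto simp: vec_eq_iff lbfgs_L_def lbfgs_T_def lbfgs_D_def
      strict_lower_def strict_upper_def diagonal_part_def)

text \<open>
  The coefficient \<open>\<theta> = \<tau> - \<delta> \<tau>\<^sup>2\<close> collects the share \<open>\<tau>\<close> of the Gram matrix of \<open>[S Z]\<close>
  and the share \<open>- \<delta> \<tau>\<^sup>2\<close> of the middle matrix.  The strictly lower part of \<open>S\<^sup>T Y\<close> meets its
  counterpart in the middle matrix and so carries \<open>\<theta>\<close>; the upper triangular part occurs in the Gram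
  matrix alone and keeps the factor \<open>\<tau>\<close>.
\<close>

lemma lbfgs_capacitance_block:
  fixes S Y Z :: "real^('l::{finite,linorder})^'n"
  assumes SZ: "transpose S ** Z = transpose S ** Y" and \<theta>: "\<theta> = \<tau> * (1 - \<delta> * \<tau>)"
  shows "block2x2
           (\<theta> *\<^sub>R (transpose S ** S))
           (\<theta> *\<^sub>R lbfgs_L S Y + \<tau> *\<^sub>R lbfgs_T S Y)
           (\<theta> *\<^sub>R transpose (lbfgs_L S Y) + \<tau> *\<^sub>R transpose (lbfgs_T S Y))
           (\<tau> *\<^sub>R (\<tau> *\<^sub>R lbfgs_D S Y + transpose Z ** Z))
         = \<tau> *\<^sub>R (transpose (hcat S Z) ** hcat S Z) - \<tau>\<^sup>2 *\<^sub>R lbfgs_middle \<delta> S Y"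
proof -
  have SZ': "transpose S ** Z = lbfgs_L S Y + lbfgs_T S Y"
    by (simp add: SZ lbfgs_triangular_splitting)
  have ZS: "transpose Z ** S = transpose (lbfgs_L S Y) + transpose (lbfgs_T S Y)"
    using arg_cong[OF SZ', of transpose] by (simp add: matrix_transpose_mul transpose_add)
  show ?thesis
    unfolding gram_hcat lbfgs_middle_def scaleR_block2x2 diff_block2x2 SZ' ZS
    by (simp add: \<theta> algebra_simps power2_eq_square)
qed

text \<open>
  The shift \<open>\<sigma>\<close> and the scaling \<open>\<gamma>\<close> both multiply the identity, so compression merges them into one
  multiple of \<open>P\<close>; the low-rank term only has its outer factor \<open>[S Y]\<close> projected.
\<close>

lemma project_shifted_lbfgs:
  fixes P :: "real^'n^'n" and S Y :: "real^('l::{finite,linorder})^'n"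
  assumes "P ** P = P" and "transpose P = P" and "P ** S = S"
  shows "P ** (lbfgs_B \<gamma> S Y + \<sigma> *\<^sub>R mat 1) ** P
    = (\<gamma> + \<sigma>) *\<^sub>R P
      - hcat S (P ** Y) ** matrix_inv (lbfgs_middle (1 / \<gamma>) S Y) ** transpose (hcat S (P ** Y))"
proof -
  have PJ: "hcat S (P ** Y) = P ** hcat S Y"
    by (simp add: mul_hcat assms(3))
  show ?thesis
    unfolding PJ
    by (simp add: lbfgs_B_def Let_def matrix_arith matrix_transpose_mul assms(1,2)
        scaleR_add_left matrix_mul_assoc)
qed

theorem lemma2:
  fixes A :: "real^'n^'m" and S Y Z :: "real^('l::{finite,linorder})^'n"
    and B W V P :: "real^'n^'n"
    and K N :: "real^('l + 'l)^('l + 'l)"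
    and \<gamma> \<delta> \<sigma> \<tau> \<theta> :: real
  assumes "rank A = CARD('m)"
    and "A ** S = 0"
    and "\<gamma> > 0" and "\<delta> = 1 / \<gamma>" and "\<sigma> \<ge> 0"
    and "invertible (lbfgs_middle \<delta> S Y)"
    and "invertible (lbfgs_D S Y)"
    and "B = lbfgs_B \<gamma> S Y" and "posdef B"
    and "W = matrix_inv (B + \<sigma> *\<^sub>R mat 1)"
    and "V = W - W ** transpose A ** matrix_inv (A ** W ** transpose A) ** A ** W"
    and "P = mat 1 - transpose A ** matrix_inv (A ** transpose A) ** A"
    and "Z = P ** Y"
    and "\<tau> = 1 / \<delta> + \<sigma>" and "\<theta> = \<tau> * (1 - \<delta> * \<tau>)"
    and "K = block2x2
           (\<theta> *\<^sub>R (transpose S ** S))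
           (\<theta> *\<^sub>R lbfgs_L S Y + \<tau> *\<^sub>R lbfgs_T S Y)
           (\<theta> *\<^sub>R transpose (lbfgs_L S Y) + \<tau> *\<^sub>R transpose (lbfgs_T S Y))
           (\<tau> *\<^sub>R (\<tau> *\<^sub>R lbfgs_D S Y + transpose Z ** Z))"
    and "N = - matrix_inv K"
  shows "invertible K \<and>
    V = (1 / \<tau>) *\<^sub>R mat 1 +
        hcat (transpose A) (hcat S Z)
        ** block2x2 (- (1 / \<tau>) *\<^sub>R matrix_inv (A ** transpose A)) 0 0 N
        ** vcat A (vcat (transpose S) (transpose Z))"
proof -
  define H where "H = B + \<sigma> *\<^sub>R mat 1"
  define J where "J = hcat S Z"
  define C where "C = lbfgs_middle \<delta> S Y"
  define F where "F = (1 / \<tau>) *\<^sub>R P - J ** matrix_inv K ** transpose J"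
  have \<gamma>: "1 / \<delta> = \<gamma>" and \<delta>: "1 / \<gamma> = \<delta>" using assms(3,4) by simp_all
  have \<tau>: "\<tau> \<noteq> 0" using assms(3,5,14) \<gamma> by simp
  have H: "posdef H" unfolding H_def using assms(5,9) by (rule posdef_shift[rotated])
  have C: "invertible C" using assms(6) by (simp add: C_def)

  have AA: "posdef (A ** transpose A)"
    using posdef_congruence[OF posdef_mat_1 assms(1)] by simp
  have AAinv: "invertible (A ** transpose A)" by (rule posdef_invertible[OF AA])
  have AA_sym: "transpose (matrix_inv (A ** transpose A)) = matrix_inv (A ** transpose A)"
    using posdef_matrix_inv[OF AA] by (simp add: posdef_def)
  have AP: "A ** P = 0"
    by (simp add: assms(12) matrix_arith matrix_mul_assoc matrix_inv_mul_right[OF AAinv])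
  have PP: "P ** P = P"
    by (subst (1) assms(12)) (simp add: matrix_arith AP flip: matrix_mul_assoc)
  have P_sym: "transpose P = P"
    by (simp add: assms(12) transpose_diff matrix_transpose_mul AA_sym matrix_mul_assoc)
  have PS: "P ** S = S"
    by (simp add: assms(12) matrix_arith assms(2) flip: matrix_mul_assoc)
  have SP: "transpose S ** P = transpose S"
    using arg_cong[OF PS, of transpose] by (simp add: matrix_transpose_mul P_sym)
  have PZ: "P ** Z = Z" by (simp add: assms(13) matrix_mul_assoc PP)
  have PJ: "P ** J = J" by (simp add: J_def mul_hcat PS PZ)

  have K: "K = \<tau> *\<^sub>R (transpose J ** J) - \<tau>\<^sup>2 *\<^sub>R C"
    unfolding assms(16) J_def C_def
    by (rule lbfgs_capacitance_block) (simp_all add: assms(13,15) matrix_mul_assoc SP)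
  have PHP: "P ** H ** P = \<tau> *\<^sub>R P - J ** matrix_inv C ** transpose J"
    unfolding H_def J_def C_def assms(8,13,14) \<gamma>
    using project_shifted_lbfgs[OF PP P_sym PS] \<delta> by simp
  have Kinv: "invertible K"
    unfolding K
  proof (rule capacitance_invertible[OF PJ C \<tau>])
    fix w
    assume Pw: "P *v w = w" and "(\<tau> *\<^sub>R P - J ** matrix_inv C ** transpose J) *v w = 0"
    then have "w \<bullet> ((P ** H ** P) *v w) = 0" by (simp add: PHP)
    moreover have "w \<bullet> ((P ** H ** P) *v w) = (transpose P *v w) \<bullet> (H *v (P *v w))"
      by (simp add: dot_lmul_matrix flip: matrix_vector_mul_assoc)
    \<comment> \<open>On the range of \<open>P\<close> the compression and \<open>H\<close> have the same quadratic form.\<close>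
    ultimately have "w \<bullet> (H *v w) = 0" by (simp only: P_sym Pw)
    then show "w = 0" using H unfolding posdef_def by (metis less_irrefl)
  qed
  have PF: "P ** F = F"
    by (simp add: F_def matrix_arith PP PJ matrix_mul_assoc)
  have "P ** H ** P ** F = P"
    unfolding PHP F_def by (rule woodbury_on_range[OF PP P_sym PJ C K Kinv \<tau>])
  then have PHF: "P ** H ** F = P"
    using PF by (simp flip: matrix_mul_assoc)
  have W: "posdef W" and WH: "W ** H = mat 1"
    using posdef_matrix_inv[OF H] matrix_inv_mul_left[OF posdef_invertible[OF H]]
    by (simp_all add: assms(10) H_def)
  have "V = F"
  proof (rule nullspace_inverse_unique[OF WH _ assms(11) _ AP PF PHF])
    show "invertible (A ** W ** transpose A)"
      by (rule posdef_invertible[OF posdef_congruence[OF W assms(1)]])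
    show "P = mat 1 - transpose A ** (matrix_inv (A ** transpose A) ** A)"
      by (simp add: assms(12) matrix_mul_assoc)
  qed
  also have "F = (1 / \<tau>) *\<^sub>R mat 1 +
        hcat (transpose A) (hcat S Z)
        ** block2x2 (- (1 / \<tau>) *\<^sub>R matrix_inv (A ** transpose A)) 0 0 N
        ** vcat A (vcat (transpose S) (transpose Z))"
    unfolding block_diagonal_sandwich
    by (simp add: F_def J_def assms(12,17) transpose_hcat matrix_arith scaleR_diff_right)
  finally show ?thesis using Kinv by blast
qed

end
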